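(* For any fixed integer $t\geqslant 4$, $$p_c(n;K_{2,t})=\Omega\left(n^{-\frac{t}{2t-3}}\right)\quad\text{as } n\to\infty,$$ that is, there is a constant $c>0$ (depending on $t$) such that $p_c(n;K_{2,t})\geqslant c\,n^{-t/(2t-3)}$ for all sufficiently large $n$.
   Context: All graphs are finite, undirected, without loops or multiple edges. $K_{s,t}$ is the complete bipartite graph with part sizes $s$ and $t$. $H$-bootstrap process: for graphs $G$ and $H$, let $G_0=G$ and, for $i=1,2,\ldots$, let $G_i$ be the graph with vertex set $V(G)$ and edge set $E(G_{i-1})\cup E_i$, where $E_i$ is the set of all edges $e$ of the complement of $G_{i-1}$ such that adding $e$ (alone) to $G_{i-1}$ creates a new copy of $H$ (as a not necessarily induced subgraph; a new copy is one containing $e$). Let $\widehat{G}_H$ be the graph with vertex set $V(G)$ and edge set $\bigcup_{i\geqslant 0}E(G_i)$. The graph $G$ percolates in the $H$-bootstrap process if $\widehat{G}_H$ is a complete graph. $\mathbb{G}(n,p)$ is the Erdős–Rényi random graph on a fixed vertex set of size $n$, in which every two distinct vertices are adjacent independently with probability $p$. Define $$p_c(n;H)=\inf\left\{p\in[0,1] : \mathbb{P}\big(\mathbb{G}(n,p)\text{ percolates in the }H\text{-bootstrap process}\big)\geqslant \tfrac12\right\}.$$ *)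

theory Defs
  imports "HOL-Probability.Probability" "HOL-Library.Ramsey"
begin

text \<open>
  An edge is a two-element set of vertices, so the edge set of the complete graph on \<open>V\<close> is
  \<open>nsets V 2\<close>.
\<close>

record 'a graph =
  verts :: "'a set"
  edges :: "'a set set"

definition complete_bipartite :: "nat \<Rightarrow> nat \<Rightarrow> (nat + nat) graph" where
  "complete_bipartite s t =
     \<lparr>verts = {..<s} <+> {..<t}, edges = {{Inl i, Inr j} | i j. i < s \<and> j < t}\<rparr>"

definition subgraph :: "'a graph \<Rightarrow> 'a graph \<Rightarrow> bool" where
  "subgraph C G \<longleftrightarrow> verts C \<subseteq> verts G \<and> edges C \<subseteq> edges G"

definition copies :: "'b graph \<Rightarrow> 'a graph \<Rightarrow> 'a graph set" where
  "copies H G =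
     {C. subgraph C G \<and>
         (\<exists>f. inj_on f (verts H) \<and>
              C = \<lparr>verts = f ` verts H, edges = (\<lambda>e. f ` e) ` edges H\<rparr>)}"

definition add_edges :: "'a graph \<Rightarrow> 'a set set \<Rightarrow> 'a graph" where
  "add_edges G F = \<lparr>verts = verts G, edges = edges G \<union> F\<rparr>"

definition new_edges :: "'b graph \<Rightarrow> 'a graph \<Rightarrow> 'a set set" where
  "new_edges H G =
     {e \<in> nsets (verts G) 2 - edges G. \<exists>C \<in> copies H (add_edges G {e}). e \<in> edges C}"

primrec bootstrap :: "'b graph \<Rightarrow> 'a graph \<Rightarrow> nat \<Rightarrow> 'a graph" where
  "bootstrap H G 0 = G"
| "bootstrap H G (Suc i) = add_edges (bootstrap H G i) (new_edges H (bootstrap H G i))"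

definition bootstrap_closure :: "'b graph \<Rightarrow> 'a graph \<Rightarrow> 'a graph" where
  "bootstrap_closure H G = \<lparr>verts = verts G, edges = (\<Union>i. edges (bootstrap H G i))\<rparr>"

definition percolates :: "'b graph \<Rightarrow> 'a graph \<Rightarrow> bool" where
  "percolates H G \<longleftrightarrow> edges (bootstrap_closure H G) = nsets (verts G) 2"

definition random_graph :: "nat \<Rightarrow> real \<Rightarrow> nat graph pmf" where
  "random_graph n p =
     map_pmf (\<lambda>\<omega>. \<lparr>verts = {..<n}, edges = {e \<in> nsets {..<n} 2. \<omega> e}\<rparr>)
       (Pi_pmf (nsets {..<n} 2) False (\<lambda>_. bernoulli_pmf p))"

text \<open>
  The infimum is over a nonempty set that is bounded below: \<open>p = 1\<close> gives the complete graph.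
\<close>

definition critical_prob :: "nat \<Rightarrow> 'b graph \<Rightarrow> real" where
  "critical_prob n H =
     Inf {p \<in> {0..1}. measure_pmf.prob (random_graph n p) {G. percolates H G} \<ge> 1 / 2}"

end

theory Submission
  imports Defs
begin

text \<open>
  Weigh a vertex set \<open>S\<close> spanning \<open>e(S)\<close> edges by \<open>(2t - 3)|S| - t e(S)\<close>. If
  \<open>p \<le> c n powr (- t / (2t - 3))\<close>, then the expected number of vertex sets of bounded size and
  nonpositive weight is \<open>O(c)\<close>, so for small \<open>c\<close> all small sets have positive weight with
  probability more than \<open>1/2\<close>. In such a graph the process stops almost immediately. Call two
  vertices twins if they have \<open>t - 1\<close> common neighbours, that is, if they span a copy of
  \<open>K(2, t - 1)\<close>, which has the small weight \<open>t - 3\<close>. Positivity makes the copies belonging to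
  different twin pairs disjoint, and twins nonadjacent. Joining all pairs that are adjacent after
  twins have been identified gives a graph that the process cannot leave: two vertices of
  different classes with \<open>t - 1\<close> common neighbours there would span, together with the copies of
  \<open>K(2, t - 1)\<close> that are involved, a set of nonpositive weight. This graph is not complete.
\<close>

section \<open>Weights of vertex sets, and graphs whose small sets have positive weight\<close>

definition joins :: "'a set \<Rightarrow> 'a set \<Rightarrow> 'a set \<Rightarrow> bool" where
  "joins C D e \<longleftrightarrow> (\<exists>c\<in>C. \<exists>d\<in>D. e = {c, d})"

lemma joins_commute: "joins C D e \<longleftrightarrow> joins D C e"
  unfolding joins_def by (metis insert_commute)

text \<open>Weight balance for \<open>k\<close> gadgets, \<open>x\<close> single vertices and
  \<open>f\<close> cross edges, with \<open>v\<close> vertices and \<open>u\<close> edges counted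
  twice. A gadget weighs \<open>(2 * t - 3) * (t + 1) - t * (2 * t - 2) = t - 3\<close>, a vertex
  \<open>2 * t - 3\<close>. Since \<open>t * u \<le> t * v\<close>, correcting the double counts
  lowers the weight by at least \<open>(t - 3) * v \<ge> 0\<close>, so the bound survives without
  the correction.\<close>

lemma cross_edge_arith: 
  fixes t k x f u v :: int
  assumes "t * (k * (2 * t - 2) + f - u) < (2 * t - 3) * (k * (t + 1) + x - v)"
    and "t * u \<le> t * v" "0 \<le> (t - 3) * v"
  shows "t * f < (t - 3) * k + (2 * t - 3) * x"
proof -
  have "t * (k * (2 * t - 2) + f - u) = 2 * (t * t * k) - 2 * (t * k) + t * f - t * u" by algebra
  moreover have "(2 * t - 3) * (k * (t + 1) + x - v) =
      2 * (t * t * k) - t * k - 3 * k + (2 * t - 3) * x - (t - 3) * v - t * v"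
    by algebra
  moreover have "(t - 3) * k = t * k - 3 * k" by algebra
  ultimately show ?thesis using assms by linarith
qed

text \<open>The size bound \<open>(t + 1)\<^sup>2\<close> fits the largest set ever tested: at most
  \<open>t + 1\<close> classes, each contributing at most a gadget of \<open>t + 1\<close>
  vertices.\<close>

locale sparse_graph =
  fixes V :: "'a set" and E :: "'a set set" and t :: nat
  assumes t_ge: "4 \<le> t"
    and fin: "finite V"
    and E_sub: "E \<subseteq> nsets V 2"
    and sparse: "\<And>S. S \<subseteq> V \<Longrightarrow> S \<noteq> {} \<Longrightarrow> card S \<le> (t + 1)\<^sup>2 \<Longrightarrow>
                   t * card {e \<in> E. e \<subseteq> S} < (2 * t - 3) * card S"
begin

lemma finE: "finite E"
  using E_sub fin by (meson finite_imp_finite_nsets finite_subset)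

text \<open>Later counts exhibit some edges inside \<open>S\<close> rather than all of them, and
  subtract freely; hence an arbitrary family \<open>D\<close> and integers.\<close>

lemma sparse_int:
  assumes "S \<subseteq> V" "S \<noteq> {}" "card S \<le> (t + 1)\<^sup>2" "D \<subseteq> E" "\<And>e. e \<in> D \<Longrightarrow> e \<subseteq> S"
  shows "int t * int (card D) < (2 * int t - 3) * int (card S)"
proof -
  have "card D \<le> card {e \<in> E. e \<subseteq> S}"
    using assms finE by (intro card_mono) auto
  then have "t * card D < (2 * t - 3) * card S"
    using sparse[OF assms(1-3)] by (meson le_less_trans mult_le_mono2)
  moreover have "int (2 * t - 3) = 2 * int t - 3" using t_ge by simp
  ultimately show ?thesis by (metis of_nat_less_iff of_nat_mult)
qed

lemma edge_ne: "{x, y} \<in> E \<Longrightarrow> x \<noteq> y"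
  using E_sub by (force simp: nsets_def)

lemma edge_in: "{x, y} \<in> E \<Longrightarrow> x \<in> V \<and> y \<in> V"
  using E_sub by (force simp: nsets_def)

section \<open>Twin pairs and their gadgets\<close>

definition common :: "'a set \<Rightarrow> 'a set \<Rightarrow> bool" where
  "common P Q \<longleftrightarrow> card Q = t - 1 \<and> (\<forall>p\<in>P. \<forall>q\<in>Q. {p, q} \<in> E)"

definition twins :: "'a set \<Rightarrow> bool" where
  "twins P \<longleftrightarrow> P \<subseteq> V \<and> card P = 2 \<and> (\<exists>Q. common P Q)"

text \<open>A twin pair may have several sets of \<open>t - 1\<close> common neighbours; fixing one
  makes its copy of \<open>K(2, t - 1)\<close>, with vertices \<open>gadget P\<close> and edges
  \<open>gadget_edges P\<close>, a function of \<open>P\<close>.\<close>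

definition side :: "'a set \<Rightarrow> 'a set" where
  "side P = (SOME Q. common P Q)"

definition gadget :: "'a set \<Rightarrow> 'a set" where
  "gadget P = P \<union> side P"

definition gadget_edges :: "'a set \<Rightarrow> 'a set set" where
  "gadget_edges P = (\<lambda>(p, q). {p, q}) ` (P \<times> side P)"

lemma gadget_edges_iff: "e \<in> gadget_edges P \<longleftrightarrow> (\<exists>p\<in>P. \<exists>q\<in>side P. e = {p, q})"
  unfolding gadget_edges_def by auto

lemma common_side: "twins P \<Longrightarrow> common P (side P)"
  unfolding twins_def side_def by (metis someI_ex)

lemma
  assumes "twins P"
  shows card_side: "card (side P) = t - 1"
    and fin_side: "finite (side P)"
    and side_edge: "p \<in> P \<Longrightarrow> q \<in> side P \<Longrightarrow> {p, q} \<in> E"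
    and card_twins: "card P = 2"
    and fin_twins: "finite P"
    and twins_V: "P \<subseteq> V"
    and side_disjoint: "P \<inter> side P = {}"
    and gadget_V: "gadget P \<subseteq> V"
    and gadget_edges_E: "gadget_edges P \<subseteq> E"
    and gadget_edges_sub: "e \<in> gadget_edges P \<Longrightarrow> e \<subseteq> gadget P \<and> e \<noteq> {}"
    and fin_gadget: "finite (gadget P)"
    and fin_gadget_edges: "finite (gadget_edges P)"
    and card_gadget: "card (gadget P) = t + 1"
    and card_gadget_edges: "card (gadget_edges P) = 2 * (t - 1)"
proof -
  note c = common_side[OF assms, unfolded common_def]
  show 1: "card (side P) = t - 1" using c by blast
  then show 2: "finite (side P)" using t_ge by (intro card_ge_0_finite) simp
  show 3: "{p, q} \<in> E" if "p \<in> P" "q \<in> side P" for p q using c that by blast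
  show 4: "card P = 2" using assms twins_def by blast
  then show 5: "finite P" by (intro card_ge_0_finite) simp
  show 6: "P \<subseteq> V" using assms twins_def by blast
  show 7: "P \<inter> side P = {}" using 3 edge_ne by blast
  have "P \<noteq> {}" using 4 by auto
  then have 8: "side P \<subseteq> V" using 3 edge_in by blast
  then show "gadget P \<subseteq> V" using 6 gadget_def by simp
  show "gadget_edges P \<subseteq> E" using 3 unfolding gadget_edges_def by auto
  show "e \<subseteq> gadget P \<and> e \<noteq> {}" if "e \<in> gadget_edges P" for e
    using that unfolding gadget_edges_def gadget_def by auto
  show "finite (gadget P)" "finite (gadget_edges P)"
    using 2 5 unfolding gadget_def gadget_edges_def by auto
  show "card (gadget P) = t + 1"
    unfolding gadget_def using card_Un_disjoint[OF 5 2 7] 1 4 t_ge by simp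
  have "inj_on (\<lambda>(p, q). {p, q}) (P \<times> side P)"
    using 7 by (auto simp: inj_on_def doubleton_eq_iff)
  then show "card (gadget_edges P) = 2 * (t - 1)"
    unfolding gadget_edges_def using 1 4 by (simp add: card_image card_cartesian_product)
qed

text \<open>The extra edge \<open>P\<close> would lower the weight of the gadget from
  \<open>t - 3\<close> to \<open>-3\<close>.\<close>

lemma twins_not_edge:
  assumes "twins P"
  shows "P \<notin> E"
proof
  assume "P \<in> E"
  have "P \<notin> gadget_edges P"
    using side_disjoint[OF assms] unfolding gadget_edges_def by auto
  then have c: "card (insert P (gadget_edges P)) = 2 * (t - 1) + 1"
    using fin_gadget_edges[OF assms] card_gadget_edges[OF assms] by simp
  have "int t * int (card (insert P (gadget_edges P))) < (2 * int t - 3) * int (card (gadget P))"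
    using gadget_V[OF assms] card_gadget[OF assms] gadget_edges_E[OF assms] \<open>P \<in> E\<close>
      gadget_edges_sub[OF assms]
    by (intro sparse_int) (auto simp: power2_eq_square gadget_def)
  then show False
    unfolding c card_gadget[OF assms] using t_ge by (simp add: algebra_simps of_nat_diff)
qed

text \<open>Two gadgets weigh \<open>2 * (t - 3)\<close> together; sharing \<open>d\<close> vertices
  and \<open>e\<close> edges changes this by \<open>t * e - (2 * t - 3) * d\<close>. An overlap has
  too few edges to keep the weight of the union positive.\<close>

lemma gadgets_disjoint:
  assumes P: "twins P" and P': "twins P'" and "P \<noteq> P'"
  shows "gadget P \<inter> gadget P' = {}"
proof (rule ccontr)
  assume ne: "gadget P \<inter> gadget P' \<noteq> {}"
  define d where "d = card (gadget P \<inter> gadget P')"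
  define e where "e = card (gadget_edges P \<inter> gadget_edges P')"
  note fins = fin_gadget[OF P] fin_gadget[OF P'] fin_gadget_edges[OF P] fin_gadget_edges[OF P']
    fin_side[OF P] fin_side[OF P'] fin_twins[OF P] fin_twins[OF P']
  have d1: "1 \<le> d" using ne fins unfolding d_def by (simp add: Suc_leI card_gt_0_iff)
  have cV: "card (gadget P \<union> gadget P') + d = 2 * (t + 1)"
    using card_Un_Int[of "gadget P" "gadget P'"] fins card_gadget[OF P] card_gadget[OF P']
    unfolding d_def by simp
  have cE: "card (gadget_edges P \<union> gadget_edges P') + e = 4 * (t - 1)"
    using card_Un_Int[of "gadget_edges P" "gadget_edges P'"] fins
      card_gadget_edges[OF P] card_gadget_edges[OF P']
    unfolding e_def by simp
  have "2 * (t + 1) \<le> (t + 1)\<^sup>2" using t_ge by (simp add: power2_eq_square)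
  then have "int t * int (card (gadget_edges P \<union> gadget_edges P'))
      < (2 * int t - 3) * int (card (gadget P \<union> gadget P'))"
    using gadget_V[OF P] gadget_V[OF P'] gadget_edges_E[OF P] gadget_edges_E[OF P']
      gadget_edges_sub[OF P] gadget_edges_sub[OF P'] ne cV
    by (intro sparse_int) (auto, blast+)
  moreover have "int (card (gadget_edges P \<union> gadget_edges P')) = 4 * int t - 4 - int e"
    using cE t_ge by linarith
  moreover have "int (card (gadget P \<union> gadget P')) = 2 * int t + 2 - int d"
    using arg_cong[OF cV, of int] by simp
  ultimately have key: "(2 * int t - 3) * int d < 2 * int t - 6 + int t * int e"
    by (simp add: algebra_simps)
  \<comment> \<open>Shared edges are fewer than shared vertices, except possibly when each pair lies
    in the side of the other, which allows a shared 4-cycle.\<close>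
  have "e + 1 \<le> d \<or> e \<le> 4 \<and> 4 \<le> d"
  proof (cases "P \<inter> P' = {}")
    case True
    \<comment> \<open>As \<open>P\<close> and \<open>P'\<close> are disjoint, a shared edge must run
      from \<open>I\<close> to \<open>J\<close>, exchanging the roles of pair and side. Both sizes
      are at most 2, and a product of two such numbers is below their sum unless both are 0, where
      \<open>d \<ge> 1\<close> helps, or both are 2.\<close>
    define I where "I = P \<inter> side P'"
    define J where "J = P' \<inter> side P"
    have finIJ: "finite I" "finite J" using fins by (auto simp: I_def J_def)
    have "gadget_edges P \<inter> gadget_edges P' \<subseteq> (\<lambda>(p, q). {p, q}) ` (I \<times> J)"
      using True unfolding gadget_edges_def I_def J_def
      by (auto simp: doubleton_eq_iff image_iff) blast+
    then have "e \<le> card (I \<times> J)"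
      unfolding e_def using finIJ by (intro surj_card_le) auto
    then have e: "e \<le> card I * card J" by (simp add: card_cartesian_product)
    have "I \<inter> J = {}" using True by (auto simp: I_def J_def)
    moreover have "I \<union> J \<subseteq> gadget P \<inter> gadget P'" by (auto simp: I_def J_def gadget_def)
    ultimately have d: "card I + card J \<le> d"
      unfolding d_def using finIJ fins
      by (simp add: card_Un_disjoint[symmetric] card_mono)
    have "card I \<le> 2" "card J \<le> 2"
      using card_mono[of P I] card_mono[of P' J] fins card_twins[OF P] card_twins[OF P']
      by (auto simp: I_def J_def)
    then have "card I \<in> {0, 1, 2}" "card J \<in> {0, 1, 2}" by auto
    then show ?thesis using d e d1 by auto
  next
    case False
    then obtain u where u: "u \<in> P" "u \<in> P'" by blast
    obtain v where v: "P = {u, v}" "u \<noteq> v"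
      using u card_twins[OF P] by (metis card_2_iff doubleton_eq_iff insertE singletonD)
    obtain v' where v': "P' = {u, v'}" "u \<noteq> v'"
      using u card_twins[OF P'] by (metis card_2_iff doubleton_eq_iff insertE singletonD)
    have "v \<noteq> v'" using v v' assms(3) by blast
    \<comment> \<open>A shared edge is \<open>{u, q}\<close> with \<open>q\<close> on both sides, or
      it is \<open>{v, v'}\<close>. The argument \<open>v'\<close> is free to encode the latter,
      because \<open>v'\<close> is not on the side of \<open>P'\<close>.\<close>
    let ?h = "\<lambda>q. if q = v' then {v, v'} else {u, q}"
    have sub: "gadget_edges P \<inter> gadget_edges P' \<subseteq> ?h ` (gadget P \<inter> gadget P' - {u})"
    proof
      fix x assume "x \<in> gadget_edges P \<inter> gadget_edges P'"
      then have "\<exists>p\<in>P. \<exists>q\<in>side P. x = {p, q}" "\<exists>p'\<in>P'. \<exists>q'\<in>side P'. x = {p', q'}"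
        by (simp_all add: gadget_edges_iff)
      then obtain p q p' q' where x: "x = {p, q}" "x = {p', q'}" "p \<in> P" "q \<in> side P"
          "p' \<in> P'" "q' \<in> side P'"
        by (elim bexE)
      have ns: "u \<notin> side P" "v \<notin> side P" "u \<notin> side P'" "v' \<notin> side P'"
        using side_disjoint[OF P] side_disjoint[OF P'] v v' by auto
      consider "p = u" | "p = v" using x v by blast
      then show "x \<in> ?h ` (gadget P \<inter> gadget P' - {u})"
      proof cases
        case 1
        then have "p' = u" "q' = q" using x ns v' by (auto simp: doubleton_eq_iff)
        then have "q \<noteq> v'" "q \<noteq> u" "q \<in> gadget P \<inter> gadget P'"
          using x ns by (auto simp: gadget_def)
        then show ?thesis using 1 x by (intro image_eqI[of _ _ q]) auto
      next
        case 2
        then have "q = v'" using x ns v v' \<open>v \<noteq> v'\<close> by (auto simp: doubleton_eq_iff)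
        then have "v' \<in> gadget P \<inter> gadget P'" using x v' by (auto simp: gadget_def)
        then show ?thesis using 2 x \<open>q = v'\<close> v' by (intro image_eqI[of _ _ v']) auto
      qed
    qed
    have "finite (gadget P \<inter> gadget P' - {u})" using fins by simp
    then have "e \<le> card (gadget P \<inter> gadget P' - {u})"
      unfolding e_def using sub by (rule surj_card_le)
    moreover have "u \<in> gadget P \<inter> gadget P'" using u by (auto simp: gadget_def)
    ultimately have "e + 1 \<le> d"
      using fins d1 card_Suc_Diff1[of "gadget P \<inter> gadget P'" u] unfolding d_def by simp
    then show ?thesis ..
  qed
  then show False
  proof
    assume "e + 1 \<le> d"
    then have "int t * int e \<le> int t * (int d - 1)" by (intro mult_left_mono) auto
    with key have "(int t - 3) * int d < int t - 3" by (simp add: algebra_simps)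
    moreover have "(int t - 3) * 1 \<le> (int t - 3) * int d"
      using t_ge d1 by (intro mult_left_mono) auto
    ultimately show False by simp
  next
    assume "e \<le> 4 \<and> 4 \<le> d"
    then have 1: "int t * int e \<le> int t * 4" by (intro mult_left_mono) auto
    have "(2 * int t - 3) * 4 \<le> (2 * int t - 3) * int d"
      using t_ge \<open>e \<le> 4 \<and> 4 \<le> d\<close> by (intro mult_left_mono) auto
    also note key
    also have "2 * int t - 6 + int t * int e \<le> 2 * int t - 6 + int t * 4" using 1 by (rule add_left_mono)
    finally show False using t_ge by simp
  qed
qed

lemma twins_unique: "twins P \<Longrightarrow> twins P' \<Longrightarrow> x \<in> gadget P \<Longrightarrow> x \<in> gadget P' \<Longrightarrow> P = P'"
  using gadgets_disjoint by blast

section \<open>Edges between gadgets and single vertices\<close>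

text \<open>
  Applies positivity of the weight to \<open>X\<close> together with all the gadgets. An edge of \<open>F\<close> that is
  already an edge of a gadget would be counted twice; it is paid for by its endpoint in \<open>X\<close>, which
  then lies in that gadget and is a vertex counted twice.
\<close>

lemma cross_edge_bound:
  assumes TT: "finite TT" "\<And>P. P \<in> TT \<Longrightarrow> twins P"
    and X: "X \<subseteq> V" "\<And>x P. x \<in> X \<Longrightarrow> twins P \<Longrightarrow> x \<notin> P"
    and ne: "TT \<noteq> {} \<or> X \<noteq> {}"
    and small: "card TT + card X \<le> t + 1"
    and F: "F \<subseteq> E"
    and F_joins: "\<And>e. e \<in> F \<Longrightarrow>
        \<exists>C \<in> TT \<union> (\<lambda>x. {x}) ` X. \<exists>D \<in> TT \<union> (\<lambda>x. {x}) ` X. C \<noteq> D \<and> joins C D e"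
    and F_unique: "\<And>C D e e'. C \<in> TT \<union> (\<lambda>x. {x}) ` X \<Longrightarrow> D \<in> TT \<union> (\<lambda>x. {x}) ` X \<Longrightarrow>
        e \<in> F \<Longrightarrow> e' \<in> F \<Longrightarrow> joins C D e \<Longrightarrow> joins C D e' \<Longrightarrow> e = e'"
  shows "int t * int (card F) < (int t - 3) * int (card TT) + (2 * int t - 3) * int (card X)"
proof -
  define K where "K = (\<Union>P\<in>TT. gadget P)"
  define L where "L = (\<Union>P\<in>TT. gadget_edges P)"
  have finX: "finite X" using X(1) fin finite_subset by blast
  have finF: "finite F" using F finE finite_subset by blast
  have finK: "finite K" using TT fin_gadget by (auto simp: K_def)
  have finL: "finite L" using TT fin_gadget_edges by (auto simp: L_def)
  have cK: "card K = card TT * (t + 1)"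
  proof -
    have "card K = (\<Sum>P\<in>TT. card (gadget P))"
      unfolding K_def using TT fin_gadget gadgets_disjoint by (intro card_UN_disjoint) auto
    also have "\<dots> = (\<Sum>P\<in>TT. t + 1)" using TT card_gadget by (intro sum.cong) auto
    finally show ?thesis by simp
  qed
  have cL: "card L = card TT * (2 * (t - 1))"
  proof -
    have "gadget_edges P \<inter> gadget_edges P' = {}" if "P \<in> TT" "P' \<in> TT" "P \<noteq> P'" for P P'
      using gadgets_disjoint[of P P'] gadget_edges_sub TT that by blast
    then have "card L = (\<Sum>P\<in>TT. card (gadget_edges P))"
      unfolding L_def using TT fin_gadget_edges by (intro card_UN_disjoint) auto
    also have "\<dots> = (\<Sum>P\<in>TT. 2 * (t - 1))" using TT card_gadget_edges by (intro sum.cong) auto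
    finally show ?thesis by simp
  qed
  \<comment> \<open>Matches a doubly counted edge with its endpoint \<open>y\<close> in
    \<open>X\<close>. Disjointness of gadgets recovers \<open>P\<close> from \<open>y\<close>, and
    \<open>F_unique\<close> then recovers the edge.\<close>
  define r where "r e y \<longleftrightarrow> (\<exists>P\<in>TT. y \<in> side P \<and> joins P {y} e)" for e y
  have overlap: "card (F \<inter> L) \<le> card (X \<inter> K)"
  proof (rule card_le_if_inj_on_rel[where r = r])
    show "finite (X \<inter> K)" using finX by simp
  next
    fix e assume "e \<in> F \<inter> L"
    then obtain P where P: "P \<in> TT" "e \<in> gadget_edges P" by (auto simp: L_def)
    then obtain p q where pq: "p \<in> P" "q \<in> side P" "e = {p, q}" by (auto simp: gadget_edges_def)
    obtain C D where CD: "C \<in> TT \<union> (\<lambda>x. {x}) ` X" "D \<in> TT \<union> (\<lambda>x. {x}) ` X" "C \<noteq> D"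
        "p \<in> C" "q \<in> D"
    proof -
      obtain C D c d where *: "C \<in> TT \<union> (\<lambda>x. {x}) ` X" "D \<in> TT \<union> (\<lambda>x. {x}) ` X" "C \<noteq> D"
        "c \<in> C" "d \<in> D" "e = {c, d}"
        using F_joins[of e] \<open>e \<in> F \<inter> L\<close> unfolding joins_def by blast
      then show ?thesis using pq that[of C D] that[of D C] by (auto simp: doubleton_eq_iff)
    qed
    have "C = P"
      using CD(1,4) pq(1) P(1) TT(2) X(2) twins_unique[of C P p] by (auto simp: gadget_def)
    \<comment> \<open>Otherwise \<open>D\<close> would meet the gadget of \<open>P\<close> in
      \<open>q\<close> and coincide with \<open>P = C\<close>.\<close>
    have "D \<notin> TT"
      using CD(3,5) \<open>C = P\<close> pq(2) P(1) TT(2) twins_unique[of D P q] by (auto simp: gadget_def)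
    then have "q \<in> X" using CD by auto
    moreover have "q \<in> K" using P pq by (auto simp: K_def gadget_def)
    moreover have "r e q" unfolding r_def joins_def using P pq by blast
    ultimately show "\<exists>b. b \<in> X \<inter> K \<and> r e b" by blast
  next
    fix e1 e2 y assume *: "e1 \<in> F \<inter> L" "e2 \<in> F \<inter> L" "y \<in> X \<inter> K" "r e1 y" "r e2 y"
    then obtain P1 P2 where P12: "P1 \<in> TT" "y \<in> side P1" "joins P1 {y} e1"
      "P2 \<in> TT" "y \<in> side P2" "joins P2 {y} e2" unfolding r_def by blast
    then have "P1 = P2" using TT(2) twins_unique[of P1 P2 y] by (auto simp: gadget_def)
    then show "e1 = e2" using F_unique[of P1 "{y}" e1 e2] P12 * by auto
  qed
  have cS: "card (K \<union> X) + card (X \<inter> K) = card TT * (t + 1) + card X"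
    using card_Un_Int[of K X] finK finX cK by (simp add: Int_commute)
  have cD: "card (L \<union> F) + card (F \<inter> L) = card TT * (2 * (t - 1)) + card F"
    using card_Un_Int[of L F] finL finF cL by (simp add: Int_commute)
  have "card (K \<union> X) \<le> (t + 1)\<^sup>2"
  proof -
    have "card (K \<union> X) \<le> card TT * (t + 1) + card X" using cS by linarith
    also have "\<dots> \<le> (card TT + card X) * (t + 1)" by (simp add: algebra_simps)
    also have "\<dots> \<le> (t + 1) * (t + 1)" using small by (intro mult_right_mono) auto
    finally show ?thesis by (simp add: power2_eq_square)
  qed
  moreover have "K \<union> X \<noteq> {}"
  proof -
    have "gadget P \<noteq> {}" if "P \<in> TT" for P using card_gadget[OF TT(2)[OF that]] by auto
    then show ?thesis using ne unfolding K_def by auto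
  qed
  moreover have "e \<subseteq> K \<union> X" if e: "e \<in> L \<union> F" for e
  proof (cases "e \<in> L")
    case True
    then show ?thesis using gadget_edges_sub TT(2) unfolding L_def K_def by blast
  next
    case False
    then obtain C D c d where "C \<in> TT \<union> (\<lambda>x. {x}) ` X" "D \<in> TT \<union> (\<lambda>x. {x}) ` X"
        "c \<in> C" "d \<in> D" "e = {c, d}"
      using F_joins[of e] e unfolding joins_def by blast
    then show ?thesis unfolding K_def gadget_def by auto
  qed
  moreover have "K \<union> X \<subseteq> V" using X(1) TT(2) gadget_V by (auto simp: K_def)
  moreover have "L \<union> F \<subseteq> E" using F TT(2) gadget_edges_E by (auto simp: L_def)
  ultimately have main: "int t * int (card (L \<union> F)) < (2 * int t - 3) * int (card (K \<union> X))"
    by (intro sparse_int) auto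
  have iS: "int (card (K \<union> X)) = int (card TT) * (int t + 1) + int (card X) - int (card (X \<inter> K))"
  proof -
    have "int (card (K \<union> X)) + int (card (X \<inter> K)) = int (card TT) * (int t + 1) + int (card X)"
      using arg_cong[OF cS, of int] by (simp add: algebra_simps)
    then show ?thesis by simp
  qed
  have iD: "int (card (L \<union> F)) = int (card TT) * (2 * int t - 2) + int (card F) - int (card (F \<inter> L))"
  proof -
    have "int (card (L \<union> F)) + int (card (F \<inter> L)) = int (card TT) * (2 * int t - 2) + int (card F)"
    proof -
      have "int (2 * (t - 1)) = 2 * int t - 2" using t_ge by simp
      then show ?thesis using arg_cong[OF cD, of int] by (simp only: of_nat_add of_nat_mult)
    qed
    then show ?thesis by simp
  qed
  have 1: "int t * int (card (F \<inter> L)) \<le> int t * int (card (X \<inter> K))"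
    using overlap by (intro mult_left_mono) auto
  have 2: "0 \<le> (int t - 3) * int (card (X \<inter> K))" using t_ge by simp
  show ?thesis using cross_edge_arith[OF main[unfolded iS iD] 1 2] .
qed

section \<open>Vertices modulo twins\<close>

text \<open>Disjointness of gadgets leaves at most one \<open>P\<close> in the union, so a class is
  a single vertex or a twin pair.\<close>

definition cl :: "'a \<Rightarrow> 'a set" where
  "cl x = {x} \<union> \<Union>{P. twins P \<and> x \<in> P}"

lemma cl_twins:
  assumes "twins P" "x \<in> P"
  shows "cl x = P"
proof -
  have "P' = P" if "twins P'" "x \<in> P'" for P'
    using twins_unique[OF that(1) assms(1), of x] that assms by (simp add: gadget_def)
  then have "{P'. twins P' \<and> x \<in> P'} = {P}" using assms by blast
  then show ?thesis unfolding cl_def using assms by auto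
qed

lemma cl_cases:
  obtains "twins (cl x)" | "cl x = {x}" "\<And>P. twins P \<Longrightarrow> x \<notin> P"
proof (cases "\<exists>P. twins P \<and> x \<in> P")
  case True
  then obtain P where P: "twins P" "x \<in> P" by blast
  then have "cl x = P" by (rule cl_twins)
  with P(1) have "twins (cl x)" by simp
  then show ?thesis by (rule that(1))
next
  case False
  then have "cl x = {x}" unfolding cl_def by blast
  then show ?thesis using that(2) False by blast
qed

lemma mem_cl: "x \<in> cl x" by (simp add: cl_def)

lemma cl_eq:
  assumes "y \<in> cl x"
  shows "cl y = cl x"
proof (cases rule: cl_cases[of x])
  case 1
  then show ?thesis using cl_twins assms by blast
next
  case 2
  then show ?thesis using assms by simp
qed

text \<open>Adjacency of classes, lifted back to vertices. This is the graph that the process cannot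
  leave.\<close>

definition near :: "'a \<Rightarrow> 'a \<Rightarrow> bool" where
  "near x y \<longleftrightarrow> (\<exists>e\<in>E. joins (cl x) (cl y) e)"

lemma near_commute: "near x y \<longleftrightarrow> near y x"
  unfolding near_def using joins_commute by blast

text \<open>An edge inside a class would be a loop or would make twins adjacent.\<close>

lemma near_cl_ne:
  assumes "near x y"
  shows "cl x \<noteq> cl y"
proof
  assume eq: "cl x = cl y"
  obtain c d where cd: "c \<in> cl x" "d \<in> cl x" "{c, d} \<in> E"
    using assms eq unfolding near_def joins_def by auto
  show False
  proof (cases rule: cl_cases[of x])
    case 1
    have "{c, d} = cl x"
    proof (rule card_subset_eq)
      show "finite (cl x)" using fin_twins[OF 1] .
      show "card {c, d} = card (cl x)" using edge_ne[OF cd(3)] card_twins[OF 1] by simp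
    qed (use cd in auto)
    then show False using twins_not_edge[OF 1] cd(3) by simp
  next
    case 2
    then show False using cd edge_ne by (metis singletonD)
  qed
qed

lemma edge_near: "{x, y} \<in> E \<Longrightarrow> near x y"
  unfolding near_def joins_def using mem_cl by blast

text \<open>Classes partition the vertices, so the endpoints of an edge determine its two classes up
  to order.\<close>

lemma joins_cl_unique:
  assumes "joins (cl a) (cl b) e" "joins (cl c) (cl d) e"
  shows "cl a = cl c \<and> cl b = cl d \<or> cl a = cl d \<and> cl b = cl c"
proof -
  obtain w x y z where *: "w \<in> cl a" "x \<in> cl b" "y \<in> cl c" "z \<in> cl d" "e = {w, x}" "e = {y, z}"
    using assms unfolding joins_def by blast
  then have "w = y \<and> x = z \<or> w = z \<and> x = y" by (auto simp: doubleton_eq_iff)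
  then show ?thesis using * cl_eq by metis
qed

section \<open>Classes with many common neighbours\<close>

text \<open>
  Suppose \<open>W\<close> meets \<open>m\<close> classes and \<open>k\<close> of the \<open>m + 2\<close> classes involved are twin pairs. The \<open>2 m\<close>
  cross edges give \<open>3 m + t k < 4 t - 6\<close>, while \<open>t - 1 \<le> m + k\<close> because classes have at most two
  elements. This forces \<open>k = 0\<close>, and then \<open>a\<close> and \<open>a'\<close> are twins themselves.
\<close>

lemma common_near_imp_cl_eq:
  assumes V: "a \<in> V" "a' \<in> V" "W \<subseteq> V" and cW: "card W = t - 1"
    and near: "\<And>w. w \<in> W \<Longrightarrow> near a w" "\<And>w. w \<in> W \<Longrightarrow> near a' w"
  shows "cl a = cl a'"
proof (rule ccontr)
  assume ne: "cl a \<noteq> cl a'"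
  define Z where "Z = {a, a'} \<union> W"
  define DD where "DD = cl ` W"
  define TT where "TT = {C \<in> cl ` Z. twins C}"
  define X where "X = {x \<in> Z. cl x = {x}}"
  have finW: "finite W" using V(3) fin finite_subset by blast
  then have finZ: "finite Z" by (simp add: Z_def)
  have notin: "cl a \<notin> DD" "cl a' \<notin> DD" using near near_cl_ne unfolding DD_def by blast+
  have CC: "cl ` Z = TT \<union> (\<lambda>x. {x}) ` X"
  proof
    show "cl ` Z \<subseteq> TT \<union> (\<lambda>x. {x}) ` X"
    proof
      fix C assume "C \<in> cl ` Z"
      then obtain x where x: "x \<in> Z" "C = cl x" by blast
      show "C \<in> TT \<union> (\<lambda>x. {x}) ` X"
        by (cases rule: cl_cases[of x]) (use x in \<open>auto simp: TT_def X_def\<close>)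
    qed
    show "TT \<union> (\<lambda>x. {x}) ` X \<subseteq> cl ` Z" unfolding TT_def X_def by force
  qed
  have Xno: "x \<notin> P" if "x \<in> X" "twins P" for x P
    using that cl_twins[of P x] card_twins[of P] unfolding X_def by auto
  have finTT: "finite TT" "finite X" using finZ by (auto simp: TT_def X_def)
  have "TT \<inter> (\<lambda>x. {x}) ` X = {}" using Xno unfolding TT_def by auto
  then have kx: "card TT + card X = card (cl ` Z)"
    unfolding CC using finTT by (simp add: card_Un_disjoint card_image inj_on_def)
  have cZ: "card (cl ` Z) = card DD + 2"
  proof -
    have "cl ` Z = insert (cl a) (insert (cl a') DD)" unfolding Z_def DD_def by auto
    then show ?thesis using notin ne finW by (simp add: DD_def)
  qed
  have mW: "card DD \<le> t - 1" using card_image_le[OF finW, of cl] cW by (simp add: DD_def)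
  \<comment> \<open>One edge of \<open>E\<close> is selected for each pair of near classes in
    \<open>R\<close>; these selected edges are the cross edges that get counted.\<close>
  define eps where "eps = (\<lambda>(C, D). SOME e. e \<in> E \<and> joins C D e)"
  define R where "R = {cl a, cl a'} \<times> DD"
  have eps: "eps (C, D) \<in> E \<and> joins C D (eps (C, D))" if "(C, D) \<in> R" for C D
  proof -
    have "\<exists>e. e \<in> E \<and> joins C D e" using that near unfolding R_def DD_def near_def by auto
    then show ?thesis unfolding eps_def prod.case by (rule someI_ex)
  qed
  have R_cl: "\<exists>c\<in>{a, a'}. \<exists>w\<in>W. C = cl c \<and> D = cl w" if "(C, D) \<in> R" for C D
    using that unfolding R_def DD_def by auto
  have same: "(C, D) = (C', D')"
    if CD: "(C, D) \<in> R" "(C', D') \<in> R" "joins C D e" "joins C' D' e" for C D C' D' e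
  proof -
    obtain c w c' w' where "C = cl c" "D = cl w" "C' = cl c'" "D' = cl w'"
      "c \<in> {a, a'}" "w \<in> W" "c' \<in> {a, a'}" "w' \<in> W"
      using R_cl[OF CD(1)] R_cl[OF CD(2)] by (elim bexE conjE)
    then have "C = C' \<and> D = D' \<or> C = D' \<and> D = C'"
      using joins_cl_unique[of c w e c' w'] that(3,4) by simp
    \<comment> \<open>The swapped order is impossible: first components are \<open>cl a\<close> or
      \<open>cl a'\<close>, which are not classes of vertices of \<open>W\<close>.\<close>
    moreover have "C \<noteq> D'" using that(1,2) notin unfolding R_def by auto
    ultimately show ?thesis by simp
  qed
  have inj: "inj_on eps R"
  proof (rule inj_onI)
    fix z z' assume *: "z \<in> R" "z' \<in> R" "eps z = eps z'"
    obtain C D C' D' where z: "z = (C, D)" "z' = (C', D')" by (cases z, cases z')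
    show "z = z'" using same[of C D C' D' "eps z"] eps[of C D] eps[of C' D'] * z by simp
  qed
  have cF: "card (eps ` R) = 2 * card DD"
    using card_image[OF inj] ne by (simp add: R_def card_cartesian_product)
  have "int t * int (card (eps ` R)) < (int t - 3) * int (card TT) + (2 * int t - 3) * int (card X)"
  proof (rule cross_edge_bound)
    show "finite TT" by fact
    show "twins P" if "P \<in> TT" for P using that by (simp add: TT_def)
    show "X \<subseteq> V" using V by (auto simp: X_def Z_def)
    show "x \<notin> P" if "x \<in> X" "twins P" for x P using Xno that .
    have "cl a \<in> TT \<union> (\<lambda>x. {x}) ` X" unfolding CC[symmetric] Z_def by blast
    then show "TT \<noteq> {} \<or> X \<noteq> {}" by blast
    show "card TT + card X \<le> t + 1" using kx cZ mW t_ge by simp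
    show "eps ` R \<subseteq> E" using eps by auto
  next
    fix e assume "e \<in> eps ` R"
    then obtain C D where CD: "(C, D) \<in> R" "e = eps (C, D)" by auto
    then obtain c w where "C = cl c" "D = cl w" "c \<in> {a, a'}" "w \<in> W" using R_cl[OF CD(1)] by blast
    moreover have "C \<noteq> D" using CD(1) notin unfolding R_def by auto
    ultimately show "\<exists>C \<in> TT \<union> (\<lambda>x. {x}) ` X. \<exists>D \<in> TT \<union> (\<lambda>x. {x}) ` X. C \<noteq> D \<and> joins C D e"
      unfolding CC[symmetric] Z_def using CD eps by blast
  next
    fix C D e e'
    assume CD: "C \<in> TT \<union> (\<lambda>x. {x}) ` X" "D \<in> TT \<union> (\<lambda>x. {x}) ` X"
      and e: "e \<in> eps ` R" "e' \<in> eps ` R" and j: "joins C D e" "joins C D e'"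
    obtain c d where cd: "C = cl c" "D = cl d" using CD unfolding CC[symmetric] by blast
    obtain A B where AB: "(A, B) \<in> R" "e = eps (A, B)" using e by auto
    obtain A' B' where AB': "(A', B') \<in> R" "e' = eps (A', B')" using e by auto
    obtain x y x' y' where xy: "A = cl x" "B = cl y" "A' = cl x'" "B' = cl y'"
      using R_cl[OF AB(1)] R_cl[OF AB'(1)] by blast
    have 1: "A = C \<and> B = D \<or> A = D \<and> B = C"
      using joins_cl_unique[of x y e c d] eps[OF AB(1)] AB(2) j(1) xy cd by simp
    have 2: "A' = C \<and> B' = D \<or> A' = D \<and> B' = C"
      using joins_cl_unique[of x' y' e' c d] eps[OF AB'(1)] AB'(2) j(2) xy cd by simp
    have "A \<noteq> B'" "A' \<noteq> B" using AB(1) AB'(1) notin unfolding R_def by auto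
    then show "e = e'" using 1 2 AB(2) AB'(2) by auto
  qed
  then have ineq: "2 * int t * int (card DD) < (int t - 3) * int (card TT) + (2 * int t - 3) * int (card X)"
    unfolding cF by simp
  have xe: "int (card X) = int (card DD) + 2 - int (card TT)" using kx cZ by linarith
  \<comment> \<open>A single class covers one vertex of \<open>W\<close>, a twin class at most two,
    so \<open>W\<close> exceeds the number of its classes by at most the number of twin
    classes.\<close>
  have Wbound: "t - 1 \<le> card DD + card TT"
  proof -
    define W1 where "W1 = {w \<in> W. cl w = {w}}"
    define T2 where "T2 = {D \<in> DD. twins D}"
    have fin2: "finite W1" "finite T2" using finW by (auto simp: W1_def T2_def DD_def)
    have "W \<subseteq> W1 \<union> \<Union>T2"
    proof
      fix w assume w: "w \<in> W"
      show "w \<in> W1 \<union> \<Union>T2"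
        by (cases rule: cl_cases[of w]) (use w mem_cl in \<open>auto simp: W1_def T2_def DD_def\<close>)
    qed
    then have "card W \<le> card (W1 \<union> \<Union>T2)"
      using fin2 fin_twins by (intro card_mono) (auto simp: T2_def)
    also have "\<dots> \<le> card W1 + card (\<Union>T2)" by (rule card_Un_le)
    also have "card (\<Union>T2) \<le> (\<Sum>D\<in>T2. card D)"
      using card_Union_le_sum_card by blast
    also have "(\<Sum>D\<in>T2. card D) = (\<Sum>D\<in>T2. 2)"
      using card_twins by (intro sum.cong) (auto simp: T2_def)
    finally have 1: "card W \<le> card W1 + 2 * card T2" by simp
    have "(\<lambda>x. {x}) ` W1 \<union> T2 \<subseteq> DD" unfolding W1_def T2_def DD_def by force
    moreover have "(\<lambda>x. {x}) ` W1 \<inter> T2 = {}" using card_twins by (force simp: T2_def)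
    ultimately have 2: "card W1 + card T2 \<le> card DD"
      using fin2 finW card_mono[of DD "(\<lambda>x. {x}) ` W1 \<union> T2"]
      by (simp add: card_Un_disjoint card_image inj_on_def DD_def)
    have "T2 \<subseteq> TT" unfolding T2_def TT_def DD_def Z_def by blast
    then have "card T2 \<le> card TT" using finTT card_mono by blast
    then show ?thesis using 1 2 cW by simp
  qed
  \<comment> \<open>With \<open>m = card DD\<close> and \<open>k = card TT\<close>,
    \<open>m \<ge> t - 1 - k\<close> gives
    \<open>3 * m + t * k \<ge> 3 * t - 3 + (t - 3) * k\<close>, which is at least
    \<open>4 * t - 6\<close> once \<open>k \<ge> 1\<close>.\<close>
  have "card TT = 0"
  proof (rule ccontr)
    assume "card TT \<noteq> 0"
    then have "(int t - 3) * 1 \<le> (int t - 3) * int (card TT)"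
      using t_ge by (intro mult_left_mono) auto
    moreover have "int t - 1 \<le> int (card DD) + int (card TT)" using Wbound t_ge by linarith
    ultimately show False using ineq unfolding xe by (simp add: algebra_simps)
  qed
  then have "TT = {}" using finTT by simp
  then have single: "cl x = {x}" if "x \<in> Z" for x
  proof (cases rule: cl_cases[of x])
    case 1
    then have "cl x \<in> TT" using that by (simp add: TT_def)
    with \<open>TT = {}\<close> show ?thesis by simp
  qed
  have "{c, w} \<in> E" if "c \<in> {a, a'}" "w \<in> W" for c w
  proof -
    have "near c w" using near that by blast
    moreover have "cl c = {c}" "cl w = {w}" using that by (auto intro!: single simp: Z_def)
    ultimately show ?thesis unfolding near_def joins_def by auto
  qed
  then have "common {a, a'} W" using cW unfolding common_def by blast
  moreover have "a \<noteq> a'" using ne by auto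
  ultimately have "twins {a, a'}" unfolding twins_def using V by auto
  then show False using cl_twins ne by (metis insertCI)
qed

section \<open>The process stays inside the graph of near pairs\<close>

text \<open>Let a new edge \<open>{a, b}\<close> complete a copy of \<open>K(2, t)\<close> with
  \<open>a\<close>, \<open>a'\<close> on the small side. The other \<open>t - 1\<close> vertices of
  the large side are near both, so \<open>a\<close> and \<open>a'\<close> have the same class.
  Nearness depends on classes only, so \<open>near a' b\<close> yields
  \<open>near a b\<close>.\<close>

lemma bootstrap_edges_near:
  assumes G: "G = \<lparr>verts = V, edges = E\<rparr>"
  shows "verts (bootstrap (complete_bipartite 2 t) G i) = V \<and>
    edges (bootstrap (complete_bipartite 2 t) G i) \<subseteq> {{x, y} | x y. x \<in> V \<and> y \<in> V \<and> near x y}"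
proof (induction i)
  case 0
  have "e \<in> {{x, y} | x y. x \<in> V \<and> y \<in> V \<and> near x y}" if "e \<in> E" for e
  proof -
    have "e \<in> nsets V 2" using that E_sub by blast
    then obtain x y where "e = {x, y}" unfolding nsets_2_eq by blast
    then show ?thesis using that edge_near edge_in by blast
  qed
  then show ?case using G by auto
next
  case (Suc i)
  let ?H = "complete_bipartite 2 t"
  define B where "B = bootstrap ?H G i"
  define N where "N = {{x, y} | x y. x \<in> V \<and> y \<in> V \<and> near x y}"
  have IH: "verts B = V" "edges B \<subseteq> N" using Suc by (auto simp: B_def N_def)
  have N_iff: "{x, y} \<in> N \<longleftrightarrow> x \<in> V \<and> y \<in> V \<and> near x y" for x y
    unfolding N_def using near_commute by (auto simp: doubleton_eq_iff)
  have "e \<in> N" if new: "e \<in> new_edges ?H B" for e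
  proof -
    obtain C where C: "C \<in> copies ?H (add_edges B {e})" "e \<in> edges C"
      and eV: "e \<in> nsets V 2"
      using new IH unfolding new_edges_def by auto
    then obtain f where inj: "inj_on f ({..<2::nat} <+> {..<t})"
      and edg: "edges C = (\<lambda>x. f ` x) ` {{Inl i, Inr j} | i j. i < (2::nat) \<and> j < t}"
      and sub: "edges C \<subseteq> insert e (edges B)"
      unfolding copies_def subgraph_def add_edges_def complete_bipartite_def by auto
    have fe: "{f (Inl i), f (Inr j)} \<in> edges C" if "i < 2" "j < t" for i j
    proof -
      have "{Inl i, Inr j} \<in> {{Inl i, Inr j :: nat + nat} | i j. i < 2 \<and> j < t}" using that by blast
      then have "f ` {Inl i, Inr j} \<in> edges C" unfolding edg by (rule imageI)
      then show ?thesis by simp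
    qed
    obtain i j where ij: "i < 2" "j < t" "e = {f (Inl i), f (Inr j)}"
      using C(2) unfolding edg by auto
    \<comment> \<open>The other index of the small side, which is indexed by 0 and 1.\<close>
    define i' where "i' = 1 - i"
    have i': "i' < 2" "i' \<noteq> i" using ij(1) unfolding i'_def by presburger+
    define a a' b where "a = f (Inl i)" and "a' = f (Inl i')" and "b = f (Inr j)"
    define W where "W = (\<lambda>k. f (Inr k)) ` ({..<t} - {j})"
    have fl: "f (Inl k) = f (Inl l) \<longleftrightarrow> k = l" if "k < 2" "l < 2" for k l
      using inj that by (auto simp: inj_on_def)
    have fr: "f (Inr k) = f (Inr l) \<longleftrightarrow> k = l" if "k < t" "l < t" for k l
      using inj that by (auto simp: inj_on_def)
    have flr: "f (Inl k) \<noteq> f (Inr l)" if "k < 2" "l < t" for k l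
      using inj that by (auto simp: inj_on_def Plus_def)
    have old: "{f (Inl k), f (Inr l)} \<in> N" if "k < 2" "l < t" "(k, l) \<noteq> (i, j)" for k l
    proof -
      have "{f (Inl k), f (Inr l)} \<noteq> e"
        using that ij fl[of k i] fr[of l j] flr[of k j] flr[of i l] by (auto simp: doubleton_eq_iff)
      then show ?thesis using fe[OF that(1,2)] sub IH(2) by auto
    qed
    have "card W = t - 1"
    proof -
      have "inj_on (\<lambda>k. f (Inr k)) ({..<t} - {j})" using fr by (auto simp: inj_on_def)
      then show ?thesis unfolding W_def using ij(2) by (simp add: card_image)
    qed
    moreover have aw: "a \<in> V \<and> w \<in> V \<and> near a w \<and> a' \<in> V \<and> near a' w" if "w \<in> W" for w
    proof -
      obtain k where "w = f (Inr k)" "k < t" "k \<noteq> j" using \<open>w \<in> W\<close> by (auto simp: W_def)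
      then show ?thesis using old[of i k] old[of i' k] ij i' N_iff unfolding a_def a'_def by auto
    qed
    \<comment> \<open>\<open>aw\<close> yields \<open>a \<in> V\<close> and
      \<open>a' \<in> V\<close> only through some element of \<open>W\<close>.\<close>
    moreover have "W \<noteq> {}" using \<open>card W = t - 1\<close> t_ge by auto
    ultimately have "a \<in> V" "a' \<in> V" "W \<subseteq> V" by blast+
    then have eq: "cl a = cl a'"
      by (rule common_near_imp_cl_eq[OF _ _ _ \<open>card W = t - 1\<close>]) (use aw in blast)+
    have "near a' b" using old[of i' j] ij i' N_iff unfolding a'_def b_def by auto
    then have "near a b" unfolding near_def eq .
    moreover have "a \<in> V" "b \<in> V" using eV ij unfolding a_def b_def nsets_def by auto
    ultimately show "e \<in> N" using N_iff ij(3) unfolding a_def b_def by simp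
  qed
  then show ?case using IH unfolding B_def N_def[symmetric] by (auto simp: add_edges_def)
qed

text \<open>In a complete graph of near pairs, two vertices and \<open>t - 1\<close> further ones,
  available among \<open>t + 1\<close>, would force the two into one class, although near vertices
  have different classes.\<close>

lemma not_percolates:
  assumes "t + 1 \<le> card V"
  shows "\<not> percolates (complete_bipartite 2 t) \<lparr>verts = V, edges = E\<rparr>"
proof
  assume "percolates (complete_bipartite 2 t) \<lparr>verts = V, edges = E\<rparr>"
  then have "nsets V 2 = (\<Union>i. edges (bootstrap (complete_bipartite 2 t) \<lparr>verts = V, edges = E\<rparr> i))"
    unfolding percolates_def bootstrap_closure_def by simp
  also have "\<dots> \<subseteq> {{x, y} | x y. x \<in> V \<and> y \<in> V \<and> near x y}"
    using bootstrap_edges_near[OF refl] by (intro UN_least) blast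
  finally have sub: "nsets V 2 \<subseteq> {{x, y} | x y. x \<in> V \<and> y \<in> V \<and> near x y}" .
  have all: "near x y" if "x \<in> V" "y \<in> V" "x \<noteq> y" for x y
  proof -
    have "{x, y} \<in> nsets V 2" using that by simp
    with sub obtain x' y' where "{x, y} = {x', y'}" "near x' y'" by blast
    then show ?thesis using near_commute by (metis doubleton_eq_iff)
  qed
  have "\<not> card V \<le> 1" using assms t_ge by linarith
  then obtain a a' where a: "a \<in> V" "a' \<in> V" "a \<noteq> a'"
    using fin by (metis One_nat_def card_le_Suc0_iff_eq)
  have "card (V - {a, a'}) \<ge> t - 1" using a assms fin by (simp add: card_Diff_subset)
  then obtain W where W: "W \<subseteq> V - {a, a'}" "card W = t - 1"
    by (meson obtain_subset_with_card_n)
  have "cl a = cl a'"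
    by (rule common_near_imp_cl_eq[OF a(1,2) _ W(2)]) (use a all W(1) in blast)+
  then show False using near_cl_ne[OF all[OF a]] by contradiction
qed

end

section \<open>Random graphs and the critical probability\<close>

lemma prob_random_graph_contains:
  assumes p: "0 \<le> p" "p \<le> 1" and F: "F \<subseteq> nsets {..<n} 2"
  shows "measure_pmf.prob (random_graph n p) {G. F \<subseteq> edges G} = p ^ card F"
proof -
  let ?A = "nsets {..<n} 2 :: nat set set"
  have fin: "finite ?A" by (simp add: finite_imp_finite_nsets)
  let ?B = "\<lambda>e. if e \<in> F then {True} else UNIV"
  \<comment> \<open>Containing \<open>F\<close> is a product event: coordinates in \<open>F\<close>
    are forced to be true, the others are free.\<close>
  have eq: "(\<lambda>\<omega>. \<lparr>verts = {..<n}, edges = {e \<in> ?A. \<omega> e}\<rparr>) -` {G. F \<subseteq> edges G} = Pi ?A ?B"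
    using F by (auto simp: Pi_def)
  have "measure_pmf.prob (random_graph n p) {G. F \<subseteq> edges G} =
      measure_pmf.prob (Pi_pmf ?A False (\<lambda>_. bernoulli_pmf p)) (Pi ?A ?B)"
    unfolding random_graph_def measure_map_pmf eq ..
  also have "\<dots> = (\<Prod>e\<in>?A. measure_pmf.prob (bernoulli_pmf p) (?B e))"
    using fin by (rule measure_Pi_pmf_Pi)
  also have "\<dots> = (\<Prod>e\<in>?A. if e \<in> F then p else 1)"
    using p by (intro prod.cong) (auto simp: measure_pmf_single)
  also have "\<dots> = p ^ card F"
    using fin F by (simp add: prod.If_cases Int_absorb1)
  finally show ?thesis .
qed

lemma random_graph_support:
  assumes "G \<in> set_pmf (random_graph n p)"
  shows "verts G = {..<n}" "edges G \<subseteq> nsets {..<n} 2"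
  using assms unfolding random_graph_def by auto

lemma bootstrap_edges_subset:
  assumes "edges G \<subseteq> nsets (verts G) 2"
  shows "verts (bootstrap H G i) = verts G \<and> edges (bootstrap H G i) \<subseteq> nsets (verts G) 2"
proof (induction i)
  case 0
  then show ?case using assms by simp
next
  case (Suc i)
  then show ?case by (auto simp: add_edges_def new_edges_def)
qed

lemma complete_percolates:
  assumes "edges G = nsets (verts G) 2"
  shows "percolates H G"
proof -
  have "edges (bootstrap H G i) \<subseteq> nsets (verts G) 2" for i
    using bootstrap_edges_subset[of G H i] assms by simp
  moreover have "nsets (verts G) 2 \<subseteq> edges (bootstrap H G 0)" using assms by simp
  ultimately show ?thesis
    unfolding percolates_def bootstrap_closure_def by (auto simp del: bootstrap.simps)
qed

text \<open>Bounding a real infimum from below needs a nonempty set; \<open>p = 1\<close> belongs to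
  it because the random graph is then almost surely complete.\<close>

lemma critical_prob_geI:
  assumes "\<And>p. 0 \<le> p \<Longrightarrow> p \<le> 1 \<Longrightarrow> p < x \<Longrightarrow>
      measure_pmf.prob (random_graph n p) {G. percolates H G} < 1 / 2"
  shows "x \<le> critical_prob n H"
  unfolding critical_prob_def
proof (rule cInf_greatest)
  have "{G. nsets {..<n} 2 \<subseteq> edges G} \<inter> set_pmf (random_graph n 1) \<subseteq> {G. percolates H G}"
    using random_graph_support[of _ n 1] by (intro subsetI CollectI complete_percolates) force
  then have "measure_pmf.prob (random_graph n 1) ({G. nsets {..<n} 2 \<subseteq> edges G} \<inter> set_pmf (random_graph n 1))
      \<le> measure_pmf.prob (random_graph n 1) {G. percolates H G}"
    by (intro measure_pmf.finite_measure_mono) auto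
  then have "1 \<in> {p \<in> {0..1}. 1 / 2 \<le> measure_pmf.prob (random_graph n p) {G. percolates H G}}"
    using prob_random_graph_contains[of 1 "nsets {..<n} 2" n] by (simp add: measure_Int_set_pmf)
  then show "{p \<in> {0..1}. 1 / 2 \<le> measure_pmf.prob (random_graph n p) {G. percolates H G}} \<noteq> {}"
    by blast
next
  fix p assume "p \<in> {p \<in> {0..1}. 1 / 2 \<le> measure_pmf.prob (random_graph n p) {G. percolates H G}}"
  then show "x \<le> p" using assms[of p] by force
qed

section \<open>First moment bound for small dense sets\<close>

text \<open>Union bound over the size \<open>a\<close>, the set \<open>S\<close> and its edge set
  \<open>F\<close>. A fixed \<open>F\<close> appears with probability at most
  \<open>c / n ^ a\<close>, there are at most \<open>n ^ a\<close> sets \<open>S\<close> of size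
  \<open>a\<close>, and at most \<open>2 ^ 2 ^ N\<close> choices of \<open>F\<close> for
  each.\<close>

lemma prob_dense_spot:
  fixes t n N :: nat and p c :: real
  assumes t: "2 \<le> t" and n: "1 \<le> n" and p: "0 \<le> p" "p \<le> 1" and c: "0 \<le> c" "c \<le> 1"
    and pc: "p \<le> c * real n powr (- (real t / (2 * real t - 3)))"
  shows "measure_pmf.prob (random_graph n p)
      {G. \<exists>S. S \<subseteq> {..<n} \<and> S \<noteq> {} \<and> card S \<le> N \<and>
           (2 * t - 3) * card S \<le> t * card {e \<in> edges G. e \<subseteq> S}}
      \<le> real N * 2 ^ 2 ^ N * c"
proof -
  define \<theta> where "\<theta> = real t / (2 * real t - 3)"
  let ?P = "measure_pmf.prob (random_graph n p)"
  let ?bad = "{G. \<exists>S. S \<subseteq> {..<n} \<and> S \<noteq> {} \<and> card S \<le> N \<and>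
           (2 * t - 3) * card S \<le> t * card {e \<in> edges G. e \<subseteq> S}}"
  define FF where "FF S = {F. F \<subseteq> nsets S 2 \<and> (2 * t - 3) * card S \<le> t * card F}" for S :: "nat set"
  have finFF: "finite (FF S)" if "finite S" for S
    using finite_imp_finite_nsets[OF that] unfolding FF_def by simp
  have cardFF: "card (FF S) \<le> 2 ^ 2 ^ N" if "finite S" "card S \<le> N" for S
  proof -
    have fin: "finite (nsets S 2)" using that by (simp add: finite_imp_finite_nsets)
    \<comment> \<open>A crude count is enough, since a factor depending only on \<open>N\<close> is
      absorbed by the choice of \<open>c\<close>.\<close>
    have "card (nsets S 2) \<le> card (Pow S)"
      using that by (intro card_mono) (auto simp: nsets_def)
    also have "\<dots> \<le> 2 ^ N" using that by (simp add: card_Pow)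
    finally have 1: "card (nsets S 2) \<le> 2 ^ N" .
    have "card (FF S) \<le> card (Pow (nsets S 2))"
      using fin by (intro card_mono) (auto simp: FF_def)
    also have "\<dots> = 2 ^ card (nsets S 2)" using fin by (simp add: card_Pow)
    also have "\<dots> \<le> 2 ^ 2 ^ N" using 1 by (intro power_increasing) auto
    finally show ?thesis .
  qed
  have single: "?P {G. F \<subseteq> edges G} \<le> c / real n ^ a"
    if S: "S \<in> nsets {..<n} a" "1 \<le> a" and F: "F \<in> FF S" for S F a
  proof -
    define k where "k = card F"
    have a: "card S = a" using S by (simp add: nsets_def)
    have k: "(2 * t - 3) * a \<le> t * k" using F a by (simp add: FF_def k_def)
    have "0 < (2 * t - 3) * a" using t S by simp
    \<comment> \<open>At least one edge is prescribed, so that \<open>c ^ k \<le> c\<close>.\<close>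
    with k have "1 \<le> k" by (cases k) auto
    have "F \<subseteq> nsets {..<n} 2" using F S nsets_mono[of S "{..<n}" 2] by (auto simp: FF_def nsets_def)
    then have "?P {G. F \<subseteq> edges G} = p ^ k"
      using prob_random_graph_contains p k_def by simp
    also have "\<dots> \<le> (c * real n powr (- \<theta>)) ^ k"
      using pc p by (intro power_mono) (auto simp: \<theta>_def)
    also have "\<dots> = c ^ k * real n powr (- \<theta> * real k)"
      using n by (simp add: power_mult_distrib powr_power mult.commute)
    also have "\<dots> \<le> c * real n powr (- real a)"
    proof (rule mult_mono)
      show "c ^ k \<le> c" using c power_decreasing[OF \<open>1 \<le> k\<close>, of c] by simp
      have "real ((2 * t - 3) * a) \<le> real (t * k)" using k by (simp only: of_nat_le_iff)
      then have "(2 * real t - 3) * real a \<le> real t * real k" using t by (simp add: of_nat_diff)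
      \<comment> \<open>This is where the exponent \<open>t / (2 * t - 3)\<close> comes from: at
        nonpositive weight, the edges compensate for the \<open>n ^ a\<close> choices of
        \<open>S\<close>.\<close>
      then have "real a \<le> \<theta> * real k" using t by (simp add: \<theta>_def field_simps)
      then show "real n powr (- \<theta> * real k) \<le> real n powr (- real a)"
        using n by (intro powr_mono) auto
    qed (use c in auto)
    also have "\<dots> = c / real n ^ a"
      using n by (simp add: powr_minus powr_realpow field_simps)
    finally show ?thesis .
  qed
  have sub: "?bad \<inter> set_pmf (random_graph n p) \<subseteq>
      (\<Union>a\<in>{1..N}. \<Union>S\<in>nsets {..<n} a. \<Union>F\<in>FF S. {G. F \<subseteq> edges G})"
  proof
    fix G assume G: "G \<in> ?bad \<inter> set_pmf (random_graph n p)"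
    then obtain S where S: "S \<subseteq> {..<n}" "S \<noteq> {}" "card S \<le> N"
      "(2 * t - 3) * card S \<le> t * card {e \<in> edges G. e \<subseteq> S}" by blast
    have finS: "finite S" using S(1) finite_subset by blast
    have "card S \<in> {1..N}" using S finS by (simp add: Suc_leI card_gt_0_iff)
    moreover have "S \<in> nsets {..<n} (card S)" using S finS by (simp add: nsets_def)
    moreover have "{e \<in> edges G. e \<subseteq> S} \<in> FF S"
      using S(4) random_graph_support(2)[of G n p] G by (auto simp: FF_def nsets_def)
    moreover have "{e \<in> edges G. e \<subseteq> S} \<subseteq> edges G" by blast
    ultimately show "G \<in> (\<Union>a\<in>{1..N}. \<Union>S\<in>nsets {..<n} a. \<Union>F\<in>FF S. {G. F \<subseteq> edges G})"
      by blast
  qed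
  have finn: "finite (nsets {..<n} a)" for a by (simp add: finite_imp_finite_nsets)
  have "?P ?bad = ?P (?bad \<inter> set_pmf (random_graph n p))"
    by (simp add: measure_Int_set_pmf)
  also have "\<dots> \<le> ?P (\<Union>a\<in>{1..N}. \<Union>S\<in>nsets {..<n} a. \<Union>F\<in>FF S. {G. F \<subseteq> edges G})"
    using sub by (intro measure_pmf.finite_measure_mono) auto
  also have "\<dots> \<le> (\<Sum>a\<in>{1..N}. ?P (\<Union>S\<in>nsets {..<n} a. \<Union>F\<in>FF S. {G. F \<subseteq> edges G}))"
    by (intro measure_pmf.finite_measure_subadditive_finite) auto
  also have "\<dots> \<le> (\<Sum>a\<in>{1..N}. 2 ^ 2 ^ N * c)"
  proof (rule sum_mono)
    fix a assume a: "a \<in> {1..N}"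
    have "?P (\<Union>S\<in>nsets {..<n} a. \<Union>F\<in>FF S. {G. F \<subseteq> edges G})
        \<le> (\<Sum>S\<in>nsets {..<n} a. ?P (\<Union>F\<in>FF S. {G. F \<subseteq> edges G}))"
      using finn by (intro measure_pmf.finite_measure_subadditive_finite) auto
    also have "\<dots> \<le> (\<Sum>S\<in>nsets {..<n} a. 2 ^ 2 ^ N * (c / real n ^ a))"
    proof (rule sum_mono)
      fix S assume S: "S \<in> nsets {..<n} a"
      then have S': "finite S" "card S = a" by (auto simp: nsets_def)
      have "?P (\<Union>F\<in>FF S. {G. F \<subseteq> edges G}) \<le> (\<Sum>F\<in>FF S. ?P {G. F \<subseteq> edges G})"
        using finFF[OF S'(1)] by (intro measure_pmf.finite_measure_subadditive_finite) auto
      also have "\<dots> \<le> (\<Sum>F\<in>FF S. c / real n ^ a)"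
        using single[OF S] a by (intro sum_mono) auto
      also have "\<dots> = real (card (FF S)) * (c / real n ^ a)" by simp
      also have "\<dots> \<le> real (2 ^ 2 ^ N) * (c / real n ^ a)"
        using cardFF[OF S'(1)] S'(2) a c by (intro mult_right_mono of_nat_mono) auto
      finally show "?P (\<Union>F\<in>FF S. {G. F \<subseteq> edges G}) \<le> 2 ^ 2 ^ N * (c / real n ^ a)" by simp
    qed
    also have "\<dots> = real (n choose a) / real n ^ a * (2 ^ 2 ^ N * c)"
      using binomial_eq_nsets[of n a] by (simp add: atLeast0LessThan)
    also have "\<dots> \<le> 1 * (2 ^ 2 ^ N * c)"
    proof (rule mult_right_mono)
      have "n choose a \<le> n ^ a"
      proof (cases "a \<le> n")
        case True
        then show ?thesis by (rule binomial_le_pow)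
      qed (simp add: binomial_eq_0)
      then have "real (n choose a) \<le> real n ^ a" by (metis of_nat_le_iff of_nat_power)
      then show "real (n choose a) / real n ^ a \<le> 1" using n by (simp add: divide_le_eq_1)
    qed (use c in auto)
    finally show "?P (\<Union>S\<in>nsets {..<n} a. \<Union>F\<in>FF S. {G. F \<subseteq> edges G}) \<le> 2 ^ 2 ^ N * c" by simp
  qed
  also have "\<dots> = real N * 2 ^ 2 ^ N * c" by simp
  finally show ?thesis .
qed

section \<open>From sparse random graphs to the lower bound\<close>

theorem theorem3p1:
  fixes t :: nat
  assumes "t \<ge> 4"
  shows "\<exists>c::real. c > 0 \<and>
    (\<forall>\<^sub>F n in sequentially.
       critical_prob n (complete_bipartite 2 t) \<ge> c * real n powr (- (real t / (2 * real t - 3))))"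
proof -
  define N where "N = (t + 1)\<^sup>2"
  \<comment> \<open>Chosen to make the bound of \<open>prob_dense_spot\<close> equal to
    \<open>1 / 4\<close>.\<close>
  define c :: real where "c = 1 / (4 * (real N * 2 ^ 2 ^ N))"
  have N: "1 \<le> N" by (simp add: N_def)
  have "1 * 1 \<le> real N * 2 ^ 2 ^ N" using N by (intro mult_mono) auto
  then have c: "0 < c" "c \<le> 1" by (simp_all add: c_def field_simps)
  have small: "real N * 2 ^ 2 ^ N * c < 1 / 2" using N by (simp add: c_def)
  have "c * real n powr (- (real t / (2 * real t - 3))) \<le> critical_prob n (complete_bipartite 2 t)"
    if n: "t + 1 \<le> n" for n
  proof (rule critical_prob_geI)
    fix p :: real
    assume p: "0 \<le> p" "p \<le> 1" "p < c * real n powr (- (real t / (2 * real t - 3)))"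
    let ?dense = "{G :: nat graph. \<exists>S. S \<subseteq> {..<n} \<and> S \<noteq> {} \<and> card S \<le> N \<and>
           (2 * t - 3) * card S \<le> t * card {e \<in> edges G. e \<subseteq> S}}"
    let ?perc = "{G :: nat graph. percolates (complete_bipartite 2 t) G}"
    have "G \<in> ?dense" if G: "G \<in> ?perc" "G \<in> set_pmf (random_graph n p)" for G
    proof (rule ccontr)
      assume nd: "G \<notin> ?dense"
      have "sparse_graph {..<n} (edges G) t"
      proof
        fix S :: "nat set"
        assume "S \<subseteq> {..<n}" "S \<noteq> {}" "card S \<le> (t + 1)\<^sup>2"
        then show "t * card {e \<in> edges G. e \<subseteq> S} < (2 * t - 3) * card S"
          using nd unfolding N_def by force
      qed (use assms random_graph_support(2)[OF G(2)] in auto)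
      then have "\<not> percolates (complete_bipartite 2 t) \<lparr>verts = {..<n}, edges = edges G\<rparr>"
        using n by (intro sparse_graph.not_percolates) auto
      moreover have "\<lparr>verts = {..<n}, edges = edges G\<rparr> = G"
        using random_graph_support(1)[OF G(2)] by (cases G) simp
      ultimately show False using G(1) by simp
    qed
    then have "measure_pmf.prob (random_graph n p) (?perc \<inter> set_pmf (random_graph n p))
        \<le> measure_pmf.prob (random_graph n p) ?dense"
      by (intro measure_pmf.finite_measure_mono) auto
    also have "\<dots> \<le> real N * 2 ^ 2 ^ N * c"
      using assms n p c by (intro prob_dense_spot) auto
    finally show "measure_pmf.prob (random_graph n p) ?perc < 1 / 2"
      using small by (simp add: measure_Int_set_pmf)
  qed
  then show ?thesis
    using c(1) by (intro exI[of _ c] conjI eventually_sequentiallyI[of "t + 1"]) auto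
qed

end
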